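(* For every positive integer $m$, put $\rho_m:=\nu_m-\nu_{m^+}$. Then $$\rho_m=\sum_{\substack{n\ge1\\ \sigma(n)=m}}\frac{\chi(n)}{n}\prod_{p\le\sigma(n)+1}\left(1-\frac1p\right)=\sum_{\substack{n\ge 1\\ \sigma(n)=m}}\alpha_n,$$ and for all real $x\ge 1$ and all integers $m\ge 1$, $$\#\{n\le x: f(n)=m\}=x\,\rho_m+O(2^m),$$ where the implied constant is absolute.
   Context: A positive integer $n$ is called practical if every integer between $1$ and $n$ can be written as a sum of distinct positive divisors of $n$. $\chi$ is the characteristic function of the set of practical numbers, and $\sigma(n)$ is the sum of the positive divisors of $n$. Products over $p$ run over primes; $n$ ranges over positive integers. For a positive integer $n$, $f(n)$ denotes the largest integer such that every integer in $[1,f(n)]$ can be written as a sum of distinct positive divisors of $n$. For real $y$, $$\mu_y:=1-\sum_{n<y}\frac{\chi(n)}{n}\prod_{p\le \sigma(n)+1}\left(1-\frac1p\right),\qquad \nu_y:=1-\sum_{\sigma(n)<y}\frac{\chi(n)}{n}\prod_{p\le \sigma(n)+1}\left(1-\frac1p\right),$$ and $\mu_{m^+}:=\lim_{y\to m^+}\mu_y$, $\nu_{m^+}:=\lim_{y\to m^+}\nu_y$ denote right-hand limits. For a positive integer $n$, $\alpha_n:=\mu_n-\mu_{n^+}=\frac{\chi(n)}{n}\prod_{p\le\sigma(n)+1}\left(1-\frac1p\right)$. *)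

theory Defs
  imports Complex_Main "HOL-Computational_Algebra.Primes" "HOL-Library.Indicator_Function"
begin

text \<open>
  These notions are meant for positive arguments: \<open>0\<close> has infinitely many divisors. Every
  definition and statement below that ranges over positive integers says so explicitly.
\<close>

definition divisor_sum :: "nat \<Rightarrow> nat" where
  "divisor_sum n = (\<Sum>d | d dvd n. d)"

definition sum_of_distinct_divisors :: "nat \<Rightarrow> nat \<Rightarrow> bool" where
  "sum_of_distinct_divisors n k \<longleftrightarrow> (\<exists>D. D \<subseteq> {d. d dvd n} \<and> \<Sum>D = k)"

definition practical :: "nat \<Rightarrow> bool" where
  "practical n \<longleftrightarrow> n > 0 \<and> (\<forall>k\<in>{1..n}. sum_of_distinct_divisors n k)"

definition chi :: "nat \<Rightarrow> real" where
  "chi = indicator {n. practical n}"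

text \<open>
  The maximum exists for \<open>n > 0\<close>: \<open>0\<close> is admissible (empty interval), and no admissible value
  exceeds \<open>divisor_sum n\<close>.
\<close>
definition practical_reach :: "nat \<Rightarrow> nat" where
  "practical_reach n = (GREATEST k. \<forall>j\<in>{1..k}. sum_of_distinct_divisors n j)"

definition euler_prod :: "nat \<Rightarrow> real" where
  "euler_prod k = (\<Prod>p | prime p \<and> p \<le> k. 1 - 1 / real p)"

text \<open>
  The index sets in the next two definitions are finite for every real \<open>y\<close>, since
  \<open>n \<le> divisor_sum n\<close> for \<open>n > 0\<close>.
\<close>
definition practical_mu :: "real \<Rightarrow> real" where
  "practical_mu y =
     1 - (\<Sum>n | n > 0 \<and> real n < y. chi n / real n * euler_prod (divisor_sum n + 1))"

definition practical_nu :: "real \<Rightarrow> real" where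
  "practical_nu y =
     1 - (\<Sum>n | n > 0 \<and> real (divisor_sum n) < y. chi n / real n * euler_prod (divisor_sum n + 1))"

definition practical_alpha :: "nat \<Rightarrow> real" where
  "practical_alpha n = practical_mu (real n) - Lim (at_right (real n)) practical_mu"

definition practical_rho :: "nat \<Rightarrow> real" where
  "practical_rho m = practical_nu (real m) - Lim (at_right (real m)) practical_nu"

end

theory Submission
  imports Defs
begin

text \<open>
  Every positive integer factors uniquely as \<open>n * r\<close> with \<open>n\<close> practical and \<open>r\<close> free of primes
  up to \<open>\<sigma>(n) + 1\<close>, and its reach is then \<open>\<sigma>(n)\<close>: a divisor of \<open>n * r\<close> not dividing \<open>n\<close>
  exceeds \<open>\<sigma>(n) + 1\<close>. So the integers of reach \<open>m\<close> are counted by sieving the cofactors \<open>r\<close> by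
  the primes up to \<open>m + 1\<close>, once for each practical \<open>n\<close> with \<open>\<sigma>(n) = m\<close>. There are at most \<open>m\<close>
  such \<open>n\<close>, each contributing an error of at most \<open>2\<close> to the power \<open>\<pi>(m + 1)\<close>, and since
  \<open>\<pi>(m + 1) \<le> m / 2 + 1\<close> the total error is \<open>O(2^m)\<close>.
\<close>

section \<open>Practical numbers\<close>

text \<open>Induction on the largest element \<open>b\<close>: sums avoiding \<open>b\<close> fill
  the interval from 0 to \<open>\<Sum>D\<close>, sums using \<open>b\<close> fill its translate by
  \<open>b\<close>, and \<open>b \<le> Suc (\<Sum>D)\<close> leaves no gap between the two.\<close>

lemma subset_sum_exists:
  fixes D :: "nat set"
  assumes "finite D" "\<And>d. d \<in> D \<Longrightarrow> d \<le> Suc (\<Sum>{e\<in>D. e < d})" "k \<le> \<Sum>D"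
  shows "\<exists>A\<subseteq>D. \<Sum>A = k"
  using assms
proof (induction arbitrary: k rule: finite_linorder_max_induct)
  case empty
  then show ?case by auto
next
  case (insert b D)
  have b: "b \<le> Suc (\<Sum>D)"
  proof -
    have "{e \<in> insert b D. e < b} = D" using insert.hyps by auto
    then show ?thesis using insert.prems(1)[of b] by simp
  qed
  have IH: "\<exists>A\<subseteq>D. \<Sum>A = j" if "j \<le> \<Sum>D" for j
  proof (rule insert.IH[OF _ that])
    fix d assume d: "d \<in> D"
    have "{e \<in> insert b D. e < d} = {e \<in> D. e < d}" using insert.hyps d by auto
    then show "d \<le> Suc (\<Sum>{e\<in>D. e < d})" using insert.prems(1)[of d] d by simp
  qed
  have nb: "b \<notin> D" using insert.hyps by auto
  show ?case
  proof (cases "k \<le> \<Sum>D")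
    case True
    then show ?thesis using IH[of k] by blast
  next
    case False
    have "\<Sum>(insert b D) = b + \<Sum>D" using insert.hyps nb by simp
    then have "k - b \<le> \<Sum>D" using insert.prems(2) by linarith
    then obtain A where A: "A \<subseteq> D" "\<Sum>A = k - b" using IH by blast
    have "finite A" using A insert.hyps finite_subset by blast
    then have "\<Sum>(insert b A) = b + (k - b)" using A nb by (subst sum.insert) auto
    then have "\<Sum>(insert b A) = k" using False b by simp
    then show ?thesis using A by blast
  qed
qed

lemma le_divisor_sum: "n > 0 \<Longrightarrow> n \<le> divisor_sum n"
  unfolding divisor_sum_def by (rule member_le_sum) auto

text \<open>Necessity: a representation of \<open>d - 1\<close> can only use divisors below
  \<open>d\<close>. Sufficiency is \<open>subset_sum_exists\<close>. This form of practicality can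
  be checked one divisor at a time.\<close>

lemma practical_iff_divisor_gaps:
  "practical n \<longleftrightarrow> n > 0 \<and> (\<forall>d. d dvd n \<longrightarrow> d \<le> Suc (\<Sum>{e. e dvd n \<and> e < d}))"
proof (intro iffI conjI allI impI)
  assume pr: "practical n"
  then show n: "n > 0" by (simp add: practical_def)
  fix d assume d: "d dvd n"
  show "d \<le> Suc (\<Sum>{e. e dvd n \<and> e < d})"
  proof (cases "d \<le> 1")
    case False
    have "d - 1 \<in> {1..n}" using False dvd_imp_le[OF d n] by auto
    then obtain D where D: "D \<subseteq> {d. d dvd n}" "\<Sum>D = d - 1"
      using pr unfolding practical_def sum_of_distinct_divisors_def by blast
    have fin: "finite D" by (rule finite_subset[OF D(1)]) (use n in auto)
    have "e < d" if "e \<in> D" for e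
      using member_le_sum[of e D "\<lambda>x. x"] that fin D False by simp
    then have "\<Sum>D \<le> \<Sum>{e. e dvd n \<and> e < d}"
      using D by (intro sum_mono2) auto
    then show ?thesis using D by simp
  qed simp
next
  assume H: "n > 0 \<and> (\<forall>d. d dvd n \<longrightarrow> d \<le> Suc (\<Sum>{e. e dvd n \<and> e < d}))"
  have "\<exists>A\<subseteq>{d. d dvd n}. \<Sum>A = k" if "k \<in> {1..n}" for k
  proof (rule subset_sum_exists)
    show "k \<le> \<Sum>{d. d dvd n}"
      using that le_divisor_sum[of n] by (auto simp: divisor_sum_def)
  qed (use H in auto)
  then show "practical n"
    using H unfolding practical_def sum_of_distinct_divisors_def by blast
qed

text \<open>The definition of \<open>practical\<close> asks for sums up to \<open>n\<close> only;
  the gap criterion carries them up to \<open>divisor_sum n\<close>, the reach found below.\<close>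

lemma practical_sums:
  assumes "practical n" "k \<le> divisor_sum n"
  shows "sum_of_distinct_divisors n k"
  unfolding sum_of_distinct_divisors_def
  by (rule subset_sum_exists) (use assms in \<open>auto simp: practical_iff_divisor_gaps divisor_sum_def\<close>)

lemma practical_1: "practical 1"
  by (auto simp: practical_iff_divisor_gaps)

text \<open>For a divisor \<open>d = p * d'\<close> of \<open>p * n\<close> not dividing
  \<open>n\<close>, two disjoint families lie below \<open>d\<close>: the divisors of
  \<open>n\<close> below \<open>p\<close>, with sum at least \<open>p - 1\<close>, and
  \<open>p\<close> times the divisors of \<open>n\<close> below \<open>d'\<close>, with sum at least
  \<open>d - p\<close>. Together they reach \<open>d - 1\<close>.\<close>

lemma practical_mult_prime:
  assumes n: "practical n" and p: "prime p" and le: "p \<le> Suc (divisor_sum n)"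
  shows "practical (p * n)"
proof -
  have n0: "n > 0" and gap: "\<And>d. d dvd n \<Longrightarrow> d \<le> Suc (\<Sum>{e. e dvd n \<and> e < d})"
    using n by (auto simp: practical_iff_divisor_gaps)
  have p0: "p > 0" using p prime_gt_0_nat by blast
  have small: "p \<le> Suc (\<Sum>{e. e dvd n \<and> e < p})"
  proof (cases "\<exists>d. d dvd n \<and> p \<le> d")
    case True
    \<comment> \<open>No divisor of \<open>n\<close> lies between \<open>p\<close> and the least
      divisor \<open>d \<ge> p\<close>, so the gap condition at \<open>d\<close> also bounds
      \<open>p\<close>.\<close>
    define d where "d = (LEAST d. d dvd n \<and> p \<le> d)"
    have d: "d dvd n" "p \<le> d" using LeastI_ex[OF True] by (auto simp: d_def)
    have "{e. e dvd n \<and> e < d} = {e. e dvd n \<and> e < p}"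
      using d not_less_Least[of _ "\<lambda>d. d dvd n \<and> p \<le> d"] unfolding d_def[symmetric] by fastforce
    then show ?thesis using gap[OF d(1)] d(2) by simp
  next
    case False
    then have "{e. e dvd n \<and> e < p} = {e. e dvd n}" by auto
    then show ?thesis using le by (simp add: divisor_sum_def)
  qed
  have "d \<le> Suc (\<Sum>{e. e dvd p * n \<and> e < d})" if d: "d dvd p * n" for d
  proof (cases "d dvd n")
    case True
    have "\<Sum>{e. e dvd n \<and> e < d} \<le> \<Sum>{e. e dvd p * n \<and> e < d}"
      by (rule sum_mono2) auto
    then show ?thesis using gap[OF True] by simp
  next
    case False
    then have "p dvd d"
      using d p by (metis coprime_dvd_mult_right_iff coprime_commute prime_imp_coprime)
    then obtain d' where d': "d = p * d'" by blast
    then have d'n: "d' dvd n" using d p0 by simp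
    have d'0: "d' > 0" using d'n n0 by (auto intro: Nat.gr0I)
    let ?A = "{e. e dvd n \<and> e < p}" and ?B = "(*) p ` {e. e dvd n \<and> e < d'}"
    have pd: "p \<le> d" using d' d'0 by simp
    have "\<Sum>?B = p * \<Sum>{e. e dvd n \<and> e < d'}"
      using p0 by (subst sum.reindex) (auto simp: inj_on_def sum_distrib_left)
    moreover have "p * d' \<le> p * Suc (\<Sum>{e. e dvd n \<and> e < d'})"
      using gap[OF d'n] by (rule mult_le_mono2)
    ultimately have "d \<le> p + \<Sum>?B" using d' by simp
    moreover have "\<Sum>(?A \<union> ?B) = \<Sum>?A + \<Sum>?B"
    proof (rule sum.union_disjoint)
      show "?A \<inter> ?B = {}"
        using n0 by (auto dest: dvd_imp_le)
    qed (use n0 in auto)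
    moreover have "\<Sum>(?A \<union> ?B) \<le> \<Sum>{e. e dvd p * n \<and> e < d}"
    proof (rule sum_mono2)
      show "finite {e. e dvd p * n \<and> e < d}" by simp
      have "?A \<subseteq> {e. e dvd p * n \<and> e < d}" using pd by auto
      moreover have "?B \<subseteq> {e. e dvd p * n \<and> e < d}" using d' p0 by auto
      ultimately show "?A \<union> ?B \<subseteq> {e. e dvd p * n \<and> e < d}" by (rule Un_least)
    qed simp
    ultimately show ?thesis using small by linarith
  qed
  then show ?thesis using n0 p0 by (simp add: practical_iff_divisor_gaps)
qed

section \<open>The reach of an integer\<close>

text \<open>The value \<open>Suc (divisor_sum n)\<close> is out of reach: the summands are too small
  to contain a prime factor of \<open>r\<close>, so all of them divide \<open>n\<close> and their
  sum is at most \<open>divisor_sum n\<close>.\<close>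

lemma practical_reach_eq:
  assumes n: "practical n" and r: "r > 0"
    and rough: "\<And>p. prime p \<Longrightarrow> p \<le> Suc (divisor_sum n) \<Longrightarrow> \<not> p dvd r"
  shows "practical_reach (n * r) = divisor_sum n"
  unfolding practical_reach_def
proof (rule Greatest_equality)
  have "sum_of_distinct_divisors (n * r) j" if "j \<le> divisor_sum n" for j
    using practical_sums[OF n that] dvd_mult2 unfolding sum_of_distinct_divisors_def by blast
  then show "\<forall>j\<in>{1..divisor_sum n}. sum_of_distinct_divisors (n * r) j" by simp
next
  fix k assume k: "\<forall>j\<in>{1..k}. sum_of_distinct_divisors (n * r) j"
  have n0: "n > 0" using n by (simp add: practical_def)
  show "k \<le> divisor_sum n"
  proof (rule ccontr)
    assume "\<not> k \<le> divisor_sum n"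
    then have "sum_of_distinct_divisors (n * r) (Suc (divisor_sum n))" using k by simp
    then obtain D where D: "D \<subseteq> {d. d dvd n * r}" "\<Sum>D = Suc (divisor_sum n)"
      unfolding sum_of_distinct_divisors_def by blast
    have fin: "finite D" by (rule finite_subset[OF D(1)]) (use n0 r in auto)
    have "d dvd n" if d: "d \<in> D" for d
    proof -
      have dle: "d \<le> Suc (divisor_sum n)"
        using member_le_sum[of d D "\<lambda>x. x"] d fin D by simp
      have "d dvd n * r" using D d by auto
      then obtain a b where ab: "d = a * b" "a dvd n" "b dvd r"
        using division_decomp by blast
      have "b = 1"
      proof (rule ccontr)
        assume "b \<noteq> 1"
        then obtain p where p: "prime p" "p dvd b" using prime_factor_nat by blast
        have "d > 0" using D d n0 r by (auto intro: Nat.gr0I)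
        then have "p \<le> d" using p ab by (intro dvd_imp_le) auto
        then have "\<not> p dvd r" using rough[of p] p(1) dle by simp
        then show False using dvd_trans[OF p(2) ab(3)] by simp
      qed
      then show ?thesis using ab by simp
    qed
    then have "\<Sum>D \<le> divisor_sum n"
      unfolding divisor_sum_def using n0 by (intro sum_mono2) auto
    then show False using D by simp
  qed
qed

text \<open>Take the largest practical divisor \<open>n\<close> of \<open>N\<close>. A prime
  \<open>p \<le> Suc (divisor_sum n)\<close> dividing the cofactor would make \<open>p * n\<close> a
  larger one.\<close>

lemma practical_rough_decomposition:
  assumes "N > 0"
  obtains n r where "N = n * r" "practical n" "r > 0"
    "\<And>p. prime p \<Longrightarrow> p \<le> Suc (divisor_sum n) \<Longrightarrow> \<not> p dvd r"
proof -
  let ?P = "\<lambda>n. practical n \<and> n dvd N"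
  define n where "n = (GREATEST n. ?P n)"
  have bound: "k \<le> N" if "?P k" for k using that assms dvd_imp_le by blast
  have n: "?P n"
    unfolding n_def by (rule GreatestI_nat[of ?P 1 N]) (use practical_1 bound in auto)
  then obtain r where r: "N = n * r" by blast
  have n0: "n > 0" using n by (simp add: practical_def)
  have "\<not> p dvd r" if p: "prime p" "p \<le> Suc (divisor_sum n)" for p
  proof
    assume "p dvd r"
    then have "?P (p * n)" using practical_mult_prime[of n p] n p r by auto
    then have "p * n \<le> n" unfolding n_def by (intro Greatest_le_nat[of ?P _ N]) (use bound in auto)
    then show False using n0 prime_gt_1_nat[OF p(1)] by simp
  qed
  then show thesis using that[of n r] r n assms by auto
qed

text \<open>Prime factors of \<open>n\<close> are at most \<open>y\<close>, hence \<open>n\<close>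
  is coprime to \<open>r'\<close>. Used in both directions, this gives uniqueness of the
  decomposition.\<close>

lemma rough_decomposition_dvd:
  fixes n r n' r' y :: nat
  assumes "n * r = n' * r'" "0 < n" "n \<le> y" "\<And>p. prime p \<Longrightarrow> p \<le> y \<Longrightarrow> \<not> p dvd r'"
  shows "n dvd n'"
proof -
  have "coprime n r'"
  proof (rule ccontr)
    assume "\<not> coprime n r'"
    then obtain p where p: "prime p" "p dvd n" "p dvd r'"
      using prime_factor_nat[of "gcd n r'"] by (auto simp: coprime_iff_gcd_eq_1)
    then show False using assms(2-4) dvd_imp_le[of p n] by force
  qed
  moreover have "n dvd n' * r'" using assms(1) by (metis dvd_triv_left)
  ultimately show ?thesis using coprime_dvd_mult_left_iff by blast
qed

section \<open>Sieving\<close>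

text \<open>The bound is real because the sieve recursion replaces \<open>x\<close> by
  \<open>x / real p\<close>.\<close>

definition sifted :: "nat set \<Rightarrow> real \<Rightarrow> nat set" where
  "sifted S x = {r. r \<ge> 1 \<and> real r \<le> x \<and> (\<forall>p\<in>S. \<not> p dvd r)}"

lemma finite_sifted: "finite (sifted S x)"
  by (rule finite_subset[of _ "{..nat \<lfloor>x\<rfloor>}"]) (auto simp: sifted_def le_nat_floor)

text \<open>Legendre's sieve as an induction over the primes, uniform in \<open>x\<close>. The main
  terms obey the same recursion as the counts, and each new prime at most doubles the error,
  starting from the rounding error of \<open>\<lfloor>x\<rfloor>\<close>.\<close>

lemma card_sifted_estimate:
  assumes "finite S" "\<And>p. p \<in> S \<Longrightarrow> prime p" "x \<ge> 0"
  shows "\<bar>real (card (sifted S x)) - x * (\<Prod>p\<in>S. 1 - 1 / real p)\<bar> \<le> 2 ^ card S"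
  using assms
proof (induction S arbitrary: x rule: finite_induct)
  case empty
  have "sifted {} x = {1..nat \<lfloor>x\<rfloor>}"
    using empty by (auto simp: sifted_def le_nat_iff le_floor_iff)
  then show ?case using empty by simp linarith
next
  case (insert p S)
  have p: "prime p" using insert.prems by auto
  then have p0: "p > 0" using prime_gt_0_nat by blast
  let ?E = "\<Prod>p\<in>S. 1 - 1 / real p"
  \<comment> \<open>The numbers removed by the new prime are \<open>p * k\<close> with
    \<open>k\<close> sifted by \<open>S\<close>; since \<open>p\<close> is not in \<open>S\<close>,
    multiplying by it introduces no prime of \<open>S\<close>.\<close>
  have "sifted S x - sifted (insert p S) x = (*) p ` sifted S (x / real p)" (is "?L = ?R")
  proof
    show "?L \<subseteq> ?R"
    proof
      fix r assume r: "r \<in> ?L"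
      then have "p dvd r" by (auto simp: sifted_def)
      then obtain k where k: "r = p * k" by blast
      have "k \<in> sifted S (x / real p)"
        using r k p0 by (auto simp: sifted_def field_simps intro: Nat.gr0I)
      then show "r \<in> ?R" using k by blast
    qed
    show "?R \<subseteq> ?L"
    proof
      fix r assume "r \<in> ?R"
      then obtain k where k: "r = p * k" "k \<in> sifted S (x / real p)" by blast
      have "\<not> q dvd r" if q: "q \<in> S" for q
      proof -
        have "prime q" "q \<noteq> p" using insert q by auto
        then have "\<not> q dvd p" using p primes_dvd_imp_eq by blast
        then show ?thesis using k q \<open>prime q\<close> by (auto simp: sifted_def prime_dvd_mult_iff)
      qed
      then show "r \<in> ?L" using k p0 by (auto simp: sifted_def field_simps)
    qed
  qed
  moreover have "card ((*) p ` sifted S (x / real p)) = card (sifted S (x / real p))"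
    using p0 by (intro card_image) (auto simp: inj_on_def)
  moreover have sub: "sifted (insert p S) x \<subseteq> sifted S x" by (auto simp: sifted_def)
  ultimately have "card (sifted S x) - card (sifted (insert p S) x) = card (sifted S (x / real p))"
    using card_Diff_subset[OF finite_sifted sub] by simp
  then have "real (card (sifted (insert p S) x))
      = real (card (sifted S x)) - real (card (sifted S (x / real p)))"
    using card_mono[OF finite_sifted sub] by linarith
  moreover have "x * (\<Prod>p\<in>insert p S. 1 - 1 / real p) = x * ?E - x / real p * ?E"
    using insert.hyps by (simp add: algebra_simps)
  moreover have "\<bar>real (card (sifted S x)) - x * ?E\<bar> \<le> 2 ^ card S"
    using insert by auto
  moreover have "\<bar>real (card (sifted S (x / real p))) - x / real p * ?E\<bar> \<le> 2 ^ card S"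
    using insert.IH[of "x / real p"] insert.prems by auto
  ultimately show ?case using insert.hyps by simp
qed

text \<open>Apart from 2, only odd numbers from 3 to \<open>Suc m\<close> can be prime. Halving the
  exponent leaves room in \<open>2 ^ m\<close> for the number of practical \<open>n\<close> to be
  summed over.\<close>

lemma card_primes_le: "card {p::nat. prime p \<and> p \<le> Suc m} \<le> Suc (m div 2)"
proof -
  have "{p::nat. prime p \<and> p \<le> Suc m} \<subseteq> insert 2 ((\<lambda>i. 2 * i + 1) ` {1..m div 2})"
  proof
    fix p :: nat assume "p \<in> {p. prime p \<and> p \<le> Suc m}"
    then have p: "prime p" "p \<le> Suc m" by auto
    show "p \<in> insert 2 ((\<lambda>i. 2 * i + 1) ` {1..m div 2})"
    proof (cases "p = 2")
      case False
      have p2: "p \<ge> 2" using prime_ge_2_nat[OF p(1)] .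
      then have "odd p" using primes_dvd_imp_eq[OF two_is_prime_nat p(1)] False by auto
      then obtain i where "p = 2 * i + 1" by (elim oddE)
      then show ?thesis using p(2) p2 by auto
    qed simp
  qed
  then have "card {p::nat. prime p \<and> p \<le> Suc m}
      \<le> card (insert 2 ((\<lambda>i. 2 * i + 1) ` {1..m div 2}))"
    by (rule card_mono[rotated]) simp
  also have "\<dots> \<le> Suc (card ((\<lambda>i. 2 * i + 1) ` {1..m div 2}))"
    by (rule card_insert_le_m1) auto
  also have "\<dots> \<le> Suc (m div 2)"
    using card_image_le[of "{1..m div 2}" "\<lambda>i. 2 * i + 1"] by simp
  finally show ?thesis .
qed

section \<open>Jumps of the step functions\<close>

text \<open>One lemma for both step functions: \<open>g\<close> is \<open>divisor_sum\<close> for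
  \<open>practical_nu\<close> and the identity for \<open>practical_mu\<close>. The bound
  \<open>n \<le> g n\<close> keeps the index sets finite.\<close>

lemma jump_of_step_sum:
  fixes g :: "nat \<Rightarrow> nat" and a :: "nat \<Rightarrow> real"
  assumes "\<And>n. n > 0 \<Longrightarrow> n \<le> g n"
    and F: "\<And>y. F y = 1 - (\<Sum>n | n > 0 \<and> real (g n) < y. a n)"
  shows "F (real m) - Lim (at_right (real m)) F = (\<Sum>n | n \<ge> 1 \<and> g n = m. a n)"
proof -
  let ?A = "{n. n > 0 \<and> g n < m}" and ?B = "{n. n \<ge> 1 \<and> g n = m}"
  have fin: "finite ?A" "finite ?B"
    using assms(1) by (auto intro!: finite_subset[of _ "{..m}"] intro: order_trans less_imp_le)
  \<comment> \<open>As \<open>g\<close> takes integer values, \<open>F\<close> is constant strictly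
    between \<open>m\<close> and \<open>m + 1\<close>, where the terms with \<open>g n = m\<close>
    are already included.\<close>
  have "eventually (\<lambda>y. F y = 1 - (\<Sum>n\<in>?A \<union> ?B. a n)) (at_right (real m))"
    unfolding eventually_at_right_field
  proof (intro exI[of _ "real m + 1"] conjI allI impI)
    fix y assume "real m < y" "y < real m + 1"
    then have "{n. n > 0 \<and> real (g n) < y} = ?A \<union> ?B" by auto
    then show "F y = 1 - (\<Sum>n\<in>?A \<union> ?B. a n)" by (simp add: F)
  qed simp
  then have "Lim (at_right (real m)) F = 1 - (\<Sum>n\<in>?A \<union> ?B. a n)"
    by (intro tendsto_Lim tendsto_eventually) auto
  moreover have "(\<Sum>n\<in>?A \<union> ?B. a n) = (\<Sum>n\<in>?A. a n) + (\<Sum>n\<in>?B. a n)"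
    using fin by (intro sum.union_disjoint) auto
  ultimately show ?thesis by (simp add: F)
qed

lemma practical_rho_eq:
  "practical_rho m =
     (\<Sum>n | n \<ge> 1 \<and> divisor_sum n = m. chi n / real n * euler_prod (divisor_sum n + 1))"
  unfolding practical_rho_def
  by (rule jump_of_step_sum) (simp_all add: le_divisor_sum practical_nu_def)

lemma practical_alpha_eq:
  assumes "n \<ge> 1"
  shows "practical_alpha n = chi n / real n * euler_prod (divisor_sum n + 1)"
proof -
  have "{k. k \<ge> 1 \<and> k = n} = {n}" using assms by auto
  then show ?thesis
    unfolding practical_alpha_def
    by (subst jump_of_step_sum[where g = "\<lambda>n. n"
          and a = "\<lambda>n. chi n / real n * euler_prod (divisor_sum n + 1)"])
       (simp_all add: practical_mu_def)
qed

section \<open>Integers of given reach\<close>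

text \<open>The reach of \<open>n * r\<close> is \<open>divisor_sum n\<close>, so fixing it to be
  \<open>m\<close> makes the sieving limit \<open>Suc m\<close> common to all
  \<open>n\<close>.\<close>

lemma reach_set_eq:
  "{N. N \<ge> 1 \<and> real N \<le> x \<and> practical_reach N = m} =
     (\<Union>n\<in>{n. practical n \<and> divisor_sum n = m}.
        (*) n ` sifted {p. prime p \<and> p \<le> Suc m} (x / real n))" (is "?L = ?R")
proof
  show "?L \<subseteq> ?R"
  proof
    fix N assume "N \<in> ?L"
    then have N: "N > 0" "real N \<le> x" "practical_reach N = m" by auto
    obtain n r where nr: "N = n * r" "practical n" "r > 0"
      "\<And>p. prime p \<Longrightarrow> p \<le> Suc (divisor_sum n) \<Longrightarrow> \<not> p dvd r"
      using practical_rough_decomposition[OF N(1)] by metis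
    have m: "divisor_sum n = m" using practical_reach_eq[OF nr(2-4)] nr(1) N by simp
    have "n > 0" using nr by (simp add: practical_def)
    then have "r \<in> sifted {p. prime p \<and> p \<le> Suc m} (x / real n)"
      using nr m N by (auto simp: sifted_def field_simps)
    then show "N \<in> ?R" using nr m by blast
  qed
  show "?R \<subseteq> ?L"
  proof
    fix N assume "N \<in> ?R"
    then obtain n r where nr: "practical n" "divisor_sum n = m" "N = n * r"
      "r \<in> sifted {p. prime p \<and> p \<le> Suc m} (x / real n)" by blast
    have n0: "n > 0" using nr by (simp add: practical_def)
    have "practical_reach N = m"
      using practical_reach_eq[OF nr(1), of r] nr by (auto simp: sifted_def)
    then show "N \<in> ?L" using nr n0 by (auto simp: sifted_def field_simps)
  qed
qed

lemma card_reach_set: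
  "card {N. N \<ge> 1 \<and> real N \<le> x \<and> practical_reach N = m} =
     (\<Sum>n | practical n \<and> divisor_sum n = m.
        card (sifted {p. prime p \<and> p \<le> Suc m} (x / real n)))"
proof -
  let ?I = "{n. practical n \<and> divisor_sum n = m}"
  let ?S = "\<lambda>n. sifted {p. prime p \<and> p \<le> Suc m} (x / real n)"
  have I: "0 < n" "n \<le> m" if "n \<in> ?I" for n
    using that le_divisor_sum[of n] by (auto simp: practical_def)
  \<comment> \<open>With \<open>y = Suc m\<close>, the size condition holds because
    \<open>n \<le> divisor_sum n = m\<close>.\<close>
  have dvd: "n dvd n'" if "n \<in> ?I" "r' \<in> ?S n'" "n * r = n' * r'" for n n' r r'
    using that I[OF that(1)] by (intro rough_decomposition_dvd[of n r n' r' "Suc m"]) (auto simp: sifted_def)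
  have "card (\<Union>n\<in>?I. (*) n ` ?S n) = (\<Sum>n\<in>?I. card ((*) n ` ?S n))"
  proof (rule card_UN_disjoint)
    show "finite ?I" by (rule finite_subset[of _ "{..m}"]) (simp_all add: subset_iff I(2))
    show "\<forall>n\<in>?I. finite ((*) n ` ?S n)" by (simp add: finite_sifted)
    show "\<forall>n\<in>?I. \<forall>n'\<in>?I. n \<noteq> n' \<longrightarrow> (*) n ` ?S n \<inter> (*) n' ` ?S n' = {}"
    proof (intro ballI impI equals0I)
      fix n n' N assume n: "n \<in> ?I" "n' \<in> ?I" "n \<noteq> n'"
        and "N \<in> (*) n ` ?S n \<inter> (*) n' ` ?S n'"
      then obtain r r' where "r \<in> ?S n" "r' \<in> ?S n'" "n * r = n' * r'" by auto
      then show False using dvd[of n r' n' r] dvd[of n' r n r'] n by (auto intro: dvd_antisym)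
    qed
  qed
  also have "\<dots> = (\<Sum>n\<in>?I. card (?S n))"
  proof (rule sum.cong[OF refl])
    fix n assume "n \<in> ?I"
    then show "card ((*) n ` ?S n) = card (?S n)"
      using I(1) by (intro card_image) (auto simp: inj_on_def)
  qed
  finally show ?thesis unfolding reach_set_eq .
qed

lemma card_reach_estimate:
  assumes "x \<ge> 0"
  shows "\<bar>real (card {N. N \<ge> 1 \<and> real N \<le> x \<and> practical_reach N = m}) - x * practical_rho m\<bar>
    \<le> 4 * 2 ^ m"
proof -
  let ?I = "{n. practical n \<and> divisor_sum n = m}"
  let ?P = "{p::nat. prime p \<and> p \<le> Suc m}"
  have I: "?I \<subseteq> {1..m}"
  proof
    fix n assume "n \<in> ?I"
    then show "n \<in> {1..m}" using le_divisor_sum[of n] by (auto simp: practical_def)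
  qed
  have J: "finite {n. n \<ge> 1 \<and> divisor_sum n = m}"
    by (rule finite_subset[of _ "{..m}"]) (auto intro: le_divisor_sum)
  \<comment> \<open>Restricting to practical \<open>n\<close> discards only terms where
    \<open>chi\<close> vanishes.\<close>
  have "practical_rho m = (\<Sum>n\<in>?I. chi n / real n * euler_prod (divisor_sum n + 1))"
    unfolding practical_rho_eq using J
    by (intro sum.mono_neutral_right) (auto simp: chi_def practical_def indicator_def)
  also have "x * \<dots> = (\<Sum>n\<in>?I. x / real n * euler_prod (Suc m))"
    unfolding sum_distrib_left by (intro sum.cong) (auto simp: chi_def)
  finally have "\<bar>real (card {N. N \<ge> 1 \<and> real N \<le> x \<and> practical_reach N = m}) - x * practical_rho m\<bar>
      = \<bar>\<Sum>n\<in>?I. real (card (sifted ?P (x / real n))) - x / real n * euler_prod (Suc m)\<bar>"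
    by (simp only: card_reach_set of_nat_sum sum_subtractf)
  also have "\<dots> \<le> (\<Sum>n\<in>?I. 2 ^ card ?P)"
    unfolding euler_prod_def using assms
    by (intro order_trans[OF sum_abs] sum_mono card_sifted_estimate) auto
  also have "\<dots> = real (card ?I) * 2 ^ card ?P" by simp
  \<comment> \<open>One factor bounds the number of \<open>n\<close>, at most \<open>m\<close>; the
    other is the sieve error. Their two extra factors of 2 give the constant 4.\<close>
  also have "\<dots> \<le> 2 ^ Suc (m div 2) * 2 ^ Suc (m div 2)"
  proof (intro mult_mono power_increasing card_primes_le)
    have "card ?I \<le> m" using card_mono[OF _ I] by simp
    also have "m \<le> 2 * Suc (m div 2)" by presburger
    also have "\<dots> \<le> 2 * 2 ^ (m div 2)" by (intro mult_le_mono2 Suc_leI less_exp)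
    finally have "card ?I \<le> 2 ^ Suc (m div 2)" by simp
    then have "real (card ?I) \<le> real (2 ^ Suc (m div 2))" by (simp only: of_nat_le_iff)
    then show "real (card ?I) \<le> 2 ^ Suc (m div 2)" by simp
  qed auto
  also have "\<dots> = 4 * 2 ^ (2 * (m div 2))" by (simp add: power_even_eq power2_eq_square)
  also have "\<dots> \<le> 4 * 2 ^ m" by (intro mult_left_mono power_increasing) auto
  finally show ?thesis .
qed

theorem corollary2:
  shows "(\<forall>m::nat. m \<ge> 1 \<longrightarrow>
            practical_rho m =
              (\<Sum>n | n \<ge> 1 \<and> divisor_sum n = m. chi n / real n * euler_prod (divisor_sum n + 1)) \<and>
            practical_rho m = (\<Sum>n | n \<ge> 1 \<and> divisor_sum n = m. practical_alpha n)) \<and>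
         (\<exists>C::real. \<forall>(x::real) (m::nat). x \<ge> 1 \<longrightarrow> m \<ge> 1 \<longrightarrow>
            \<bar>real (card {n::nat. n \<ge> 1 \<and> real n \<le> x \<and> practical_reach n = m}) - x * practical_rho m\<bar>
              \<le> C * 2 ^ m)"
proof (intro conjI allI impI)
  fix m :: nat
  show rho: "practical_rho m =
      (\<Sum>n | n \<ge> 1 \<and> divisor_sum n = m. chi n / real n * euler_prod (divisor_sum n + 1))"
    by (rule practical_rho_eq)
  show "practical_rho m = (\<Sum>n | n \<ge> 1 \<and> divisor_sum n = m. practical_alpha n)"
    unfolding rho by (intro sum.cong refl) (simp add: practical_alpha_eq)
next
  show "\<exists>C::real. \<forall>(x::real) (m::nat). x \<ge> 1 \<longrightarrow> m \<ge> 1 \<longrightarrow>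
      \<bar>real (card {n::nat. n \<ge> 1 \<and> real n \<le> x \<and> practical_reach n = m}) - x * practical_rho m\<bar>
        \<le> C * 2 ^ m"
    using card_reach_estimate by (intro exI[of _ 4]) auto
qed

end
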